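(* Let $f:\mathbb{C}\to\mathbb{C}$ be a composition $f=g\circ h$, where $g$ is a quadratic polynomial with complex coefficients (of degree exactly $2$) and $h$ is an affine stretch $h_{M,\phi}$ with $M>0$ and $\phi\in[-\pi,\pi]$. Then $f$ is linearly conjugate to $$f_{K,\theta,C}(z) := \left(h_{K,\theta}(z)\right)^{2}+C$$ for some $Ke^{i\theta}\in\mathbb{C}\setminus\{0\}$ and some $C\in\mathbb{C}$. Moreover, if one insists that $Ke^{i\theta}\in U$, where $$U=\{0<|z|<1,\ -\pi/4<\arg(z)\le \pi/4\}\cup\{|z|>1,\ -\pi/4<\arg(z)\le\pi/4\}\cup\{1\},$$ then such a representation is unique; that is, there is exactly one pair $(Ke^{i\theta},C)\in U\times\mathbb{C}$ such that $f$ is linearly conjugate to $f_{K,\theta,C}$.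
   Context: For $K>0$ and $\theta\in\mathbb{R}$, the affine stretch $h_{K,\theta}:\mathbb{C}\to\mathbb{C}$ by factor $K$ in the direction $e^{i\theta}$ is the $\mathbb{R}$-linear map $$h_{K,\theta}(z)=\left(\frac{K+1}{2}\right)z+e^{2i\theta}\left(\frac{K-1}{2}\right)\overline{z}.$$ (Thus $h_{K,0}(x+iy)=Kx+iy$, and $h_{1,\theta}$ is the identity for every $\theta$.) A stretch $h_{K,\theta}$ is represented by the point $Ke^{i\theta}\in\mathbb{C}\setminus\{0\}$. The notation $(h_{K,\theta}(z))^2$ means the square of the complex number $h_{K,\theta}(z)$. Two maps $f,F:\mathbb{C}\to\mathbb{C}$ are linearly conjugate if there is a map $\ell(z)=az+b$ with $a,b\in\mathbb{C}$, $a\neq0$, such that $F=\ell^{-1}\circ f\circ\ell$. *)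

theory Defs
  imports Complex_Main "HOL-Computational_Algebra.Polynomial"
begin

definition stretch :: "real \<Rightarrow> real \<Rightarrow> complex \<Rightarrow> complex" where
  "stretch K \<theta> z =
     complex_of_real ((K + 1) / 2) * z + cis (2 * \<theta>) * complex_of_real ((K - 1) / 2) * cnj z"

definition linearly_conjugate :: "(complex \<Rightarrow> complex) \<Rightarrow> (complex \<Rightarrow> complex) \<Rightarrow> bool" where
  "linearly_conjugate f F \<longleftrightarrow>
     (\<exists>a b. a \<noteq> 0 \<and> F = inv (\<lambda>z. a * z + b) \<circ> f \<circ> (\<lambda>z. a * z + b))"

definition quad_stretch :: "real \<Rightarrow> real \<Rightarrow> complex \<Rightarrow> complex \<Rightarrow> complex" where
  "quad_stretch K \<theta> C z = (stretch K \<theta> z)\<^sup>2 + C"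

(* Points w = K e^(i theta), i.e. w = rcis K theta, representing stretches. *)
definition param_region :: "complex set" where
  "param_region =
     {z. 0 < cmod z \<and> cmod z < 1 \<and> - (pi / 4) < Arg z \<and> Arg z \<le> pi / 4}
     \<union> {z. 1 < cmod z \<and> - (pi / 4) < Arg z \<and> Arg z \<le> pi / 4}
     \<union> {1}"

end

theory Submission
  imports Defs
begin

text \<open>
  Up to a positive real factor, the stretch represented by \<open>w = K e\<^sup>i\<^sup>\<theta>\<close> is the map
  \<open>z \<mapsto> z + \<mu> cnj z\<close>, where \<open>\<mu> = e\<^sup>2\<^sup>i\<^sup>\<theta> (K - 1) / (K + 1)\<close> is its Beltrami coefficient, a point
  of the open unit disc.  This suggests comparing everything with the maps
  \<open>z \<mapsto> (z + \<mu> cnj z)\<^sup>2 + c\<close>, \<open>\<bar>\<mu>\<bar> < 1\<close>, called \<open>beltrami_quad \<mu> c\<close> below.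

  These maps are a perfect normal form for linear conjugacy.  Every quadratic polynomial in
  \<open>z + \<mu> cnj z\<close> is conjugate to one of them: a translation completes the square, and a dilation
  makes the leading coefficient 1 while rotating \<open>\<mu>\<close>
  (\<open>quadratic_conjugate_beltrami_quad\<close>).  Two of them are conjugate only if
  they are equal, because the absence of linear terms excludes a translation, and comparing
  quadratic terms then forces the conjugating map to be the identity (\<open>beltrami_quad_conjugate_unique\<close>).  So \<open>f\<close> has exactly one normal form
  \<open>(\<mu>, c)\<close>.

  The map \<open>f\<^sub>K\<^sub>,\<^sub>\<theta>\<^sub>,\<^sub>C\<close> has the normal form \<open>(\<mu>, ((K + 1) / 2)\<^sup>2 C)\<close>, with the \<open>\<mu>\<close> of \<open>K e\<^sup>i\<^sup>\<theta>\<close>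
  (\<open>quad_stretch_conjugate_beltrami_quad\<close>).  Hence \<open>f\<close> is conjugate to \<open>f\<^sub>K\<^sub>,\<^sub>\<theta>\<^sub>,\<^sub>C\<close> exactly when
  \<open>K e\<^sup>i\<^sup>\<theta>\<close> has the right Beltrami coefficient and \<open>C\<close> is the value dictated by \<open>c\<close>.  Finally, \<open>U\<close> is
  a set of representatives for the Beltrami coefficient: it maps \<open>U\<close> bijectively onto the unit
  disc (\<open>bij_betw_beltrami\<close>), since a nonzero point of the disc is
  \<open>r e\<^sup>i\<^sup>t\<close> for exactly one \<open>t \<in> (-\<pi>/2, \<pi>/2]\<close> and one real \<open>r \<noteq> 0\<close>, the sign of \<open>r\<close> telling
  \<open>K > 1\<close> from \<open>K < 1\<close>.
\<close>

section \<open>Linear conjugacy\<close>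

lemma linearly_conjugate_iff:
  "linearly_conjugate f F \<longleftrightarrow> (\<exists>a b. a \<noteq> 0 \<and> (\<forall>z. f (a * z + b) = a * F z + b))"
proof -
  have "F = inv (\<lambda>z. a * z + b) \<circ> f \<circ> (\<lambda>z. a * z + b) \<longleftrightarrow> (\<forall>z. f (a * z + b) = a * F z + b)"
    if "a \<noteq> 0" for a b
  proof -
    have "inv (\<lambda>z. a * z + b) = (\<lambda>y. (y - b) / a)"
      using that by (intro inv_equality) auto
    then have "F = inv (\<lambda>z. a * z + b) \<circ> f \<circ> (\<lambda>z. a * z + b)
        \<longleftrightarrow> (\<forall>z. F z = (f (a * z + b) - b) / a)"
      by (simp only: fun_eq_iff o_apply)
    then show ?thesis
      using that by (auto simp: field_simps)
  qed
  then show ?thesis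
    unfolding linearly_conjugate_def by blast
qed

lemma linearly_conjugate_sym:
  assumes "linearly_conjugate f F"
  shows "linearly_conjugate F f"
proof -
  from assms obtain a b where a: "a \<noteq> 0" and *: "\<And>z. f (a * z + b) = a * F z + b"
    unfolding linearly_conjugate_iff by blast
  have "F (1 / a * z + - b / a) = 1 / a * f z + - b / a" for z
    using *[of "1 / a * z + - b / a"] a by (simp add: field_simps)
  then show ?thesis
    unfolding linearly_conjugate_iff using a by (intro exI[of _ "1 / a"] exI[of _ "- b / a"]) auto
qed

lemma linearly_conjugate_trans:
  assumes "linearly_conjugate f g" "linearly_conjugate g h"
  shows "linearly_conjugate f h"
proof -
  from assms obtain a b a' b' where a: "a \<noteq> 0" "a' \<noteq> 0"
    and f: "\<And>z. f (a * z + b) = a * g z + b" and g: "\<And>z. g (a' * z + b') = a' * h z + b'"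
    unfolding linearly_conjugate_iff by blast
  have "f (a * a' * z + (a * b' + b)) = a * a' * h z + (a * b' + b)" for z
    using f[of "a' * z + b'"] g[of z] by (simp add: algebra_simps)
  then show ?thesis
    unfolding linearly_conjugate_iff using a
    by (intro exI[of _ "a * a'"] exI[of _ "a * b' + b"]) auto
qed

section \<open>The normal form\<close>

definition beltrami_quad :: "complex \<Rightarrow> complex \<Rightarrow> complex \<Rightarrow> complex" where
  "beltrami_quad \<mu> c z = (z + \<mu> * cnj z)\<^sup>2 + c"

text \<open>
  The real-linear map \<open>z \<mapsto> z + \<mu> cnj z\<close> has determinant \<open>1 - \<bar>\<mu>\<bar>\<^sup>2\<close>, and Cramer's rule gives the
  preimage.
\<close>

lemma surj_add_times_cnj:
  assumes "cmod \<mu> < 1"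
  obtains b where "b + \<mu> * cnj b = e"
proof
  have "(cmod \<mu>)\<^sup>2 < 1"
    using assms by (simp add: power_less_one_iff)
  then have "1 - \<mu> * cnj \<mu> \<noteq> 0"
    by (metis complex_norm_square of_real_1 of_real_eq_iff eq_iff_diff_eq_0 less_irrefl)
  moreover have "1 - cnj \<mu> * \<mu> \<noteq> 0"
    using calculation by (simp add: mult.commute)
  ultimately show "(e - \<mu> * cnj e) / (1 - \<mu> * cnj \<mu>)
      + \<mu> * cnj ((e - \<mu> * cnj e) / (1 - \<mu> * cnj \<mu>)) = e"
    by (simp add: divide_simps) (simp add: algebra_simps)
qed

text \<open>
  The translation part of the conjugating map is chosen to complete the square.  Since
  \<open>a z + \<mu> cnj (a z) = a (z + \<mu> (cnj a / a) cnj z)\<close>, the dilation part \<open>a = 1 / \<alpha>\<close> normalises the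
  leading coefficient at the cost of multiplying \<open>\<mu>\<close> by a number of modulus 1.
\<close>

lemma quadratic_conjugate_beltrami_quad:
  assumes "\<alpha> \<noteq> 0" "cmod \<mu> < 1"
  obtains \<nu> c where "cmod \<nu> < 1"
    "linearly_conjugate
       (\<lambda>z. \<alpha> * (z + \<mu> * cnj z)\<^sup>2 + \<beta> * (z + \<mu> * cnj z) + \<gamma>) (beltrami_quad \<nu> c)"
proof -
  obtain b where b: "b + \<mu> * cnj b = - \<beta> / (2 * \<alpha>)"
    using surj_add_times_cnj[OF assms(2)] by blast
  define a where "a = 1 / \<alpha>"
  define \<nu> where "\<nu> = \<mu> * cnj a / a"
  define c where "c = (\<gamma> - \<beta>\<^sup>2 / (4 * \<alpha>) - b) / a"
  have a: "a \<noteq> 0" "\<alpha> = 1 / a"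
    using assms(1) by (simp_all add: a_def)
  have "\<alpha> * ((a * z + b) + \<mu> * cnj (a * z + b))\<^sup>2 + \<beta> * ((a * z + b) + \<mu> * cnj (a * z + b)) + \<gamma>
      = a * beltrami_quad \<nu> c z + b" for z
  proof -
    define u where "u = z + \<nu> * cnj z"
    have "(a * z + b) + \<mu> * cnj (a * z + b) = a * u + (b + \<mu> * cnj b)"
      using a by (simp add: u_def \<nu>_def field_simps)
    also have "\<dots> = a * u - \<beta> * a / 2"
      unfolding b using a by simp
    finally have eq: "(a * z + b) + \<mu> * cnj (a * z + b) = a * u - \<beta> * a / 2" .
    show ?thesis
      unfolding eq beltrami_quad_def u_def[symmetric] c_def a(2)
      using a(1) by (simp add: field_simps power2_eq_square)
  qed
  then have "linearly_conjugate
       (\<lambda>z. \<alpha> * (z + \<mu> * cnj z)\<^sup>2 + \<beta> * (z + \<mu> * cnj z) + \<gamma>) (beltrami_quad \<nu> c)"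
    unfolding linearly_conjugate_iff using a(1) by blast
  moreover have "cmod \<nu> < 1"
    using assms(2) a(1) by (simp add: \<nu>_def norm_mult norm_divide)
  ultimately show thesis
    using that by blast
qed

text \<open>
  A translation by \<open>b\<close> would create the linear term \<open>2 (b + \<mu> cnj b) (a z + \<mu> cnj (a z))\<close>, which is
  nonzero unless \<open>b = 0\<close>.  What is left is \<open>(a z + \<mu> cnj (a z))\<^sup>2 = a (z + \<nu> cnj z)\<^sup>2\<close>, where \<open>z\<^sup>2\<close> has
  the coefficients \<open>a\<^sup>2 = a\<close> and \<open>z cnj z\<close> the coefficients \<open>2 a \<mu> cnj a = 2 a \<nu>\<close>.
\<close>

lemma beltrami_quad_conjugate_unique:
  assumes "cmod \<mu> < 1" "linearly_conjugate (beltrami_quad \<mu> c) (beltrami_quad \<nu> d)"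
  shows "\<mu> = \<nu>" "c = d"
proof -
  from assms(2) obtain a b where a: "a \<noteq> 0"
    and "\<And>z. beltrami_quad \<mu> c (a * z + b) = a * beltrami_quad \<nu> d z + b"
    unfolding linearly_conjugate_iff by blast
  then have conj: "((a * z + b) + \<mu> * cnj (a * z + b))\<^sup>2 + c = a * ((z + \<nu> * cnj z)\<^sup>2 + d) + b" for z
    unfolding beltrami_quad_def by blast
  have nz: "1 + \<mu> \<noteq> 0"
    using assms(1) by (metis add.inverse_unique norm_minus_cancel norm_one less_irrefl)
  define e where "e = b + \<mu> * cnj b"
  have const: "e\<^sup>2 + c = a * d + b"
    using conj[of 0] by (simp add: e_def)
  have quad: "(a * z + \<mu> * cnj (a * z))\<^sup>2 + 2 * e * (a * z + \<mu> * cnj (a * z))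
      = a * (z + \<nu> * cnj z)\<^sup>2" for z
    using conj[of z] const unfolding e_def power2_eq_square by (simp add: algebra_simps) algebra
  \<comment> \<open>The linear term is the odd part, tested where \<open>a z + \<mu> cnj (a z) = 1 + \<mu>\<close>.\<close>
  have "e * (1 + \<mu>) = 0"
  proof -
    have "4 * (e * (1 + \<mu>)) = 0"
      using quad[of "1 / a"] quad[of "- (1 / a)"] a
      by (simp add: power2_eq_square algebra_simps) algebra
    then show ?thesis by simp
  qed
  with nz have e: "e = 0" by simp
  have b: "b = 0"
  proof -
    have "cmod b = cmod \<mu> * cmod b"
      using e unfolding e_def by (metis add_eq_0_iff complex_mod_cnj norm_minus_cancel norm_mult)
    then show ?thesis
      using assms(1) by simp
  qed
  \<comment> \<open>The values at 1, \<open>\<i>\<close> and \<open>1 + \<i>\<close> determine the three coefficients of a binary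
     quadratic form in \<open>z\<close> and \<open>cnj z\<close>.\<close>
  define A B X Y where "A = 1 + \<nu>" and "B = 1 - \<nu>"
    and "X = a + \<mu> * cnj a" and "Y = a - \<mu> * cnj a"
  have 1: "X\<^sup>2 = a * A\<^sup>2"
    using quad[of 1] e by (simp add: A_def X_def)
  have 2: "Y\<^sup>2 = a * B\<^sup>2"
  proof -
    have "(\<i> * Y)\<^sup>2 = a * (\<i> * B)\<^sup>2"
      using quad[of \<i>] e by (simp add: B_def Y_def algebra_simps)
    then show ?thesis by (simp add: power_mult_distrib)
  qed
  have 3: "X * Y = a * (A * B)"
  proof -
    have "(X + \<i> * Y)\<^sup>2 = a * (A + \<i> * B)\<^sup>2"
      using quad[of "1 + \<i>"] e by (simp add: A_def B_def X_def Y_def algebra_simps)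
    then have "X\<^sup>2 - Y\<^sup>2 + 2 * \<i> * (X * Y) = a * (A\<^sup>2 - B\<^sup>2 + 2 * \<i> * (A * B))"
      by (simp add: power2_eq_square algebra_simps)
    then have "2 * \<i> * (X * Y) = 2 * \<i> * (a * (A * B))"
      using 1 2 by (simp add: algebra_simps)
    then show ?thesis by simp
  qed
  have "(X + Y)\<^sup>2 = a * (A + B)\<^sup>2"
    using 1 2 3 by (simp add: power2_eq_square algebra_simps)
  then have a1: "a = 1"
    using a by (simp add: A_def B_def X_def Y_def power2_eq_square)
  have "(X + Y) * (X - Y) = a * ((A + B) * (A - B))"
    using 1 2 by (simp add: power2_eq_square algebra_simps)
  then show "\<mu> = \<nu>"
    using a1 by (simp add: A_def B_def X_def Y_def)
  show "c = d"
    using const e b a1 by simp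
qed

section \<open>The Beltrami coefficient of a stretch\<close>

text \<open>
  For \<open>w = K e\<^sup>i\<^sup>\<theta>\<close> the square of \<open>sgn w\<close> is \<open>e\<^sup>2\<^sup>i\<^sup>\<theta>\<close>.  Written in this way, the coefficient visibly
  depends on the point \<open>w\<close> alone and on no choice of its argument.
\<close>

definition beltrami :: "complex \<Rightarrow> complex" where
  "beltrami w = complex_of_real ((cmod w - 1) / (cmod w + 1)) * (sgn w)\<^sup>2"

lemma beltrami_rcis:
  assumes "K > 0"
  shows "beltrami (rcis K \<theta>) = rcis ((K - 1) / (K + 1)) (2 * \<theta>)"
proof -
  have "sgn (rcis K \<theta>) = cis \<theta>"
    using assms by (simp add: sgn_eq rcis_def norm_mult)
  moreover have "cmod (rcis K \<theta>) = K"
    using assms by simp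
  ultimately show ?thesis
    by (simp add: beltrami_def rcis_def Complex.DeMoivre)
qed

lemma norm_beltrami_less_1:
  assumes "w \<noteq> 0"
  shows "cmod (beltrami w) < 1"
proof -
  have "w = rcis (cmod w) (Arg w)" "cmod w > 0"
    using assms by (simp_all add: rcis_cmod_Arg)
  then have "cmod (beltrami w) = \<bar>(cmod w - 1) / (cmod w + 1)\<bar>"
    using beltrami_rcis[of "cmod w" "Arg w"] by simp
  also have "\<dots> < 1"
    using \<open>cmod w > 0\<close> by (simp add: divide_less_eq abs_less_iff add_pos_pos)
  finally show ?thesis .
qed

lemma stretch_eq_beltrami:
  assumes "K > 0"
  shows "stretch K \<theta> z = complex_of_real ((K + 1) / 2) * (z + beltrami (rcis K \<theta>) * cnj z)"
proof -
  have "(K + 1) / 2 * ((K - 1) / (K + 1)) = (K - 1) / 2"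
    using assms by (simp add: divide_simps)
  then have "complex_of_real ((K - 1) / 2)
      = complex_of_real ((K + 1) / 2) * complex_of_real ((K - 1) / (K + 1))"
    by (metis of_real_mult)
  then show ?thesis
    unfolding beltrami_rcis[OF assms] unfolding stretch_def rcis_def
    by (simp only: distrib_left mult_ac)
qed

text \<open>
  The scaling that absorbs the factor \<open>((K + 1) / 2)\<^sup>2\<close> is real, so it leaves the Beltrami
  coefficient unchanged.
\<close>

lemma quad_stretch_conjugate_beltrami_quad:
  assumes "K > 0"
  shows "linearly_conjugate (quad_stretch K \<theta> C)
           (beltrami_quad (beltrami (rcis K \<theta>)) (complex_of_real (((K + 1) / 2)\<^sup>2) * C))"
proof -
  define p where "p = complex_of_real ((K + 1) / 2)"
  have p: "p \<noteq> 0" "cnj p = p"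
    using assms unfolding p_def by (subst of_real_eq_0_iff, simp_all)
  define \<mu> where "\<mu> = beltrami (rcis K \<theta>)"
  have "quad_stretch K \<theta> C (1 / p\<^sup>2 * z + 0) = 1 / p\<^sup>2 * beltrami_quad \<mu> (p\<^sup>2 * C) z + 0" for z
  proof -
    have "stretch K \<theta> (1 / p\<^sup>2 * z + 0) = 1 / p * (z + \<mu> * cnj z)"
      unfolding stretch_eq_beltrami[OF assms] p_def[symmetric] \<mu>_def[symmetric]
      using p by (simp add: field_simps power2_eq_square)
    then have "quad_stretch K \<theta> C (1 / p\<^sup>2 * z + 0) = (1 / p)\<^sup>2 * (z + \<mu> * cnj z)\<^sup>2 + C"
      unfolding quad_stretch_def by (simp only: power_mult_distrib)
    then show ?thesis
      using p by (simp add: beltrami_quad_def power_one_over distrib_left)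
  qed
  then have "linearly_conjugate (quad_stretch K \<theta> C) (beltrami_quad \<mu> (p\<^sup>2 * C))"
    unfolding linearly_conjugate_iff using p
    by (intro exI[of _ "1 / p\<^sup>2"] exI[of _ 0]) simp
  then show ?thesis
    by (simp add: p_def \<mu>_def)
qed

section \<open>The parameter region as a fundamental domain\<close>

lemma Arg_rcis:
  assumes "K > 0" "- pi < t" "t \<le> pi"
  shows "Arg (rcis K t) = t"
proof (rule cis_Arg_unique)
  show "sgn (rcis K t) = cis t"
    using assms(1) by (simp add: sgn_eq) (simp add: rcis_def)
qed (use assms in simp_all)

lemma param_region_iff:
  "w \<in> param_region \<longleftrightarrow> w = 1 \<or>
     (\<exists>K t. w = rcis K t \<and> K > 0 \<and> K \<noteq> 1 \<and> - (pi / 4) < t \<and> t \<le> pi / 4)" (is "_ \<longleftrightarrow> ?R")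
proof
  assume "w \<in> param_region"
  then have "w = 1 \<or> cmod w > 0 \<and> cmod w \<noteq> 1 \<and> - (pi / 4) < Arg w \<and> Arg w \<le> pi / 4"
    by (auto simp: param_region_def)
  then show ?R
    by (metis rcis_cmod_Arg)
next
  assume ?R
  then show "w \<in> param_region"
  proof (elim disjE exE conjE)
    fix K t
    assume *: "w = rcis K t" "K > 0" "K \<noteq> 1" "- (pi / 4) < t" "t \<le> pi / 4"
    have "Arg w = t"
      unfolding *(1) using * pi_gt_zero by (intro Arg_rcis) linarith+
    moreover have "cmod w = K"
      using * by simp
    ultimately show ?thesis
      using * by (auto simp: param_region_def)
  qed (simp add: param_region_def)
qed

text \<open>
  Polar coordinates in which the radius takes both signs and the angle runs over a half-turn
  only.
\<close>

lemma signed_polar_exists: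
  assumes "\<mu> \<noteq> 0"
  obtains r t where "\<mu> = rcis r t" "r \<noteq> 0" "- (pi / 2) < t" "t \<le> pi / 2"
proof -
  have \<mu>: "\<mu> = rcis (cmod \<mu>) (Arg \<mu>)"
    by (simp add: rcis_cmod_Arg)
  have turn: "rcis (cmod \<mu>) (Arg \<mu>) = rcis (- cmod \<mu>) (Arg \<mu> + pi)"
    "rcis (cmod \<mu>) (Arg \<mu>) = rcis (- cmod \<mu>) (Arg \<mu> - pi)"
    by (simp_all add: rcis_def cis.ctr complex_eq_iff)
  have "- pi < Arg \<mu>" "Arg \<mu> \<le> pi"
    using Arg_bounded[of \<mu>] by auto
  then consider "- (pi / 2) < Arg \<mu> \<and> Arg \<mu> \<le> pi / 2"
    | "- (pi / 2) < Arg \<mu> + pi \<and> Arg \<mu> + pi \<le> pi / 2"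
    | "- (pi / 2) < Arg \<mu> - pi \<and> Arg \<mu> - pi \<le> pi / 2"
    by linarith
  then show thesis
    using that \<mu> turn assms by cases (metis norm_eq_zero neg_equal_0_iff_equal)+
qed

lemma signed_polar_unique:
  assumes "rcis r t = rcis r' t'" "r \<noteq> 0"
    and "- (pi / 2) < t" "t \<le> pi / 2" "- (pi / 2) < t'" "t' \<le> pi / 2"
  shows "r = r' \<and> t = t'"
proof -
  have "\<bar>r\<bar> = \<bar>r'\<bar>"
    using arg_cong[OF assms(1), of cmod] by simp
  then consider "r' = r" | "r' = - r"
    by linarith
  then show ?thesis
  proof cases
    case 1
    with assms have "cis t = cis t'"
      by (simp add: rcis_def)
    moreover have "Arg (cis t) = t" "Arg (cis t') = t'"
      using assms pi_gt_zero by (intro cis_Arg_unique; simp; linarith)+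
    ultimately show ?thesis
      using 1 by metis
  next
    case 2
    with assms(1) have "complex_of_real r * (cis t + cis t') = 0"
      by (simp add: rcis_def distrib_left)
    then have "cis t = - cis t'"
      using assms(2) by (simp add: eq_neg_iff_add_eq_0)
    then have "cos t = - cos t'" "sin t = - sin t'"
      by (simp_all add: complex_eq_iff)
    \<comment> \<open>Both cosines are nonnegative, so they vanish, and both angles are \<open>\<pi>/2\<close>.\<close>
    moreover have "cos t \<ge> 0" "cos t' \<ge> 0"
      using assms(3-6) by (intro cos_ge_zero; linarith)+
    ultimately have "cos t = 0" "cos t' = 0"
      by simp_all
    moreover have "cos s > 0" if "- (pi / 2) < s" "s < pi / 2" for s
      using that by (intro cos_gt_zero_pi)
    ultimately have "t = pi / 2" "t' = pi / 2"
      using assms by (metis less_irrefl order_le_less)+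
    with \<open>sin t = - sin t'\<close> show ?thesis
      by simp
  qed
qed

text \<open>
  In the signed polar coordinates \<open>r = (K - 1) / (K + 1)\<close> and \<open>t = 2 \<theta>\<close>, where the first formula
  identifies \<open>K \<in> (0, \<infinity>)\<close> with \<open>r \<in> (-1, 1)\<close>, with inverse \<open>K = (1 + r) / (1 - r)\<close>.
\<close>

lemma bij_betw_beltrami: "bij_betw beltrami param_region {\<mu>. cmod \<mu> < 1}"
proof (rule bij_betw_imageI)
  have nonzero: "(K - 1) / (K + 1) \<noteq> 0" if "K > 0" "K \<noteq> 1" for K :: real
    using that by simp
  have beltrami_1: "beltrami 1 = 0"
    by (simp add: beltrami_def)
  have beltrami_nz: "beltrami (rcis K t) \<noteq> 0" if "K > 0" "K \<noteq> 1" for K t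
    using nonzero[OF that] that by (simp add: beltrami_rcis)
  show "inj_on beltrami param_region"
  proof (rule inj_onI)
    fix w w'
    assume w: "w \<in> param_region" and w': "w' \<in> param_region" and eq: "beltrami w = beltrami w'"
    show "w = w'"
    proof (cases "w = 1 \<or> w' = 1")
      case True
      then show ?thesis
        using w w' eq beltrami_1 beltrami_nz unfolding param_region_iff by metis
    next
      case False
      then obtain K t K' t' where
        *: "w = rcis K t" "K > 0" "K \<noteq> 1" "- (pi / 4) < t" "t \<le> pi / 4" and
        **: "w' = rcis K' t'" "K' > 0" "K' \<noteq> 1" "- (pi / 4) < t'" "t' \<le> pi / 4"
        using w w' unfolding param_region_iff by blast
      have "rcis ((K - 1) / (K + 1)) (2 * t) = rcis ((K' - 1) / (K' + 1)) (2 * t')"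
        using eq * ** by (simp add: beltrami_rcis)
      then have "(K - 1) / (K + 1) = (K' - 1) / (K' + 1) \<and> 2 * t = 2 * t'"
        using * ** by (intro signed_polar_unique nonzero) auto
      then have "K = K'" "t = t'"
        using * ** by (simp_all add: field_simps)
      then show ?thesis
        using * ** by simp
    qed
  qed
  show "beltrami ` param_region = {\<mu>. cmod \<mu> < 1}"
  proof (intro equalityI subsetI)
    fix \<mu> assume "\<mu> \<in> beltrami ` param_region"
    moreover have "w \<noteq> 0" if "w \<in> param_region" for w
      using that by (auto simp: param_region_iff)
    ultimately show "\<mu> \<in> {\<mu>. cmod \<mu> < 1}"
      using norm_beltrami_less_1 by blast
  next
    fix \<mu> :: complex assume "\<mu> \<in> {\<mu>. cmod \<mu> < 1}"
    then have \<mu>: "cmod \<mu> < 1" by simp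
    show "\<mu> \<in> beltrami ` param_region"
    proof (cases "\<mu> = 0")
      case True
      then show ?thesis
        using beltrami_1 by (auto simp: param_region_iff image_iff intro!: bexI[of _ 1])
    next
      case False
      then obtain r t where rt: "\<mu> = rcis r t" "r \<noteq> 0" "- (pi / 2) < t" "t \<le> pi / 2"
        using signed_polar_exists by blast
      have r: "- 1 < r" "r < 1"
        using \<mu> rt by (auto simp: abs_less_iff)
      define K where "K = (1 + r) / (1 - r)"
      have K: "K > 0" "K \<noteq> 1" "(K - 1) / (K + 1) = r"
        using r rt(2) by (auto simp: K_def field_simps)
      then have "beltrami (rcis K (t / 2)) = \<mu>"
        using rt(1) by (simp add: beltrami_rcis)
      moreover have "rcis K (t / 2) \<in> param_region"
        unfolding param_region_iff using K rt(3,4)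
        by (intro disjI2 exI[of _ K] exI[of _ "t / 2"]) auto
      ultimately show ?thesis
        by blast
    qed
  qed
qed

section \<open>Existence and uniqueness of the representation\<close>

lemma degree_2_poly_eq:
  fixes g :: "'a::comm_semiring_1 poly"
  assumes "degree g = 2"
  shows "poly g x = coeff g 2 * x\<^sup>2 + coeff g 1 * x + coeff g 0"
proof -
  have "{..2::nat} = {0, 1, 2}"
    by auto
  then show ?thesis
    unfolding poly_altdef assms by (simp add: ac_simps)
qed

lemma quadratic_stretch_normal_form:
  assumes "degree g = 2" "M > 0"
  obtains \<mu> c where "cmod \<mu> < 1" "linearly_conjugate (poly g \<circ> stretch M \<phi>) (beltrami_quad \<mu> c)"
proof -
  define p where "p = complex_of_real ((M + 1) / 2)"
  define \<nu> where "\<nu> = beltrami (rcis M \<phi>)"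
  have p: "p \<noteq> 0"
    using assms unfolding p_def by (subst of_real_eq_0_iff) simp
  have "coeff g 2 \<noteq> 0"
    using assms(1) by (metis leading_coeff_0_iff degree_0 zero_neq_numeral)
  then have lead: "coeff g 2 * p\<^sup>2 \<noteq> 0"
    using p by simp
  have \<nu>: "cmod \<nu> < 1"
    unfolding \<nu>_def using assms(2) by (intro norm_beltrami_less_1) simp
  have "stretch M \<phi> z = p * (z + \<nu> * cnj z)" for z
    unfolding p_def \<nu>_def by (rule stretch_eq_beltrami[OF assms(2)])
  then have eq: "poly g \<circ> stretch M \<phi> = (\<lambda>z. (coeff g 2 * p\<^sup>2) * (z + \<nu> * cnj z)\<^sup>2
      + (coeff g 1 * p) * (z + \<nu> * cnj z) + coeff g 0)"
    by (simp add: fun_eq_iff degree_2_poly_eq[OF assms(1)] power_mult_distrib mult.assoc)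
  show thesis
    by (rule quadratic_conjugate_beltrami_quad[OF lead \<nu>, of "coeff g 1 * p" "coeff g 0"])
      (rule that, assumption, simp only: eq)
qed

theorem proposition3p1:
  fixes f :: "complex \<Rightarrow> complex" and g :: "complex poly" and M \<phi> :: real
  assumes "degree g = 2"
    and "M > 0" and "- pi \<le> \<phi>" and "\<phi> \<le> pi"
    and "f = poly g \<circ> stretch M \<phi>"
  shows "(\<exists>K>0. \<exists>\<theta> C. linearly_conjugate f (quad_stretch K \<theta> C))
    \<and> (\<exists>!(w, C) \<in> param_region \<times> UNIV.
          \<exists>K>0. \<exists>\<theta>. w = rcis K \<theta> \<and> linearly_conjugate f (quad_stretch K \<theta> C))"
proof -
  obtain \<mu> c where \<mu>: "cmod \<mu> < 1" and f: "linearly_conjugate f (beltrami_quad \<mu> c)"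
    using quadratic_stretch_normal_form[OF assms(1,2)] assms(5) by metis
  define q where "q w = complex_of_real (((cmod w + 1) / 2)\<^sup>2)" for w
  have q: "q w \<noteq> 0" for w
  proof -
    have "cmod w + 1 > 0"
      using norm_ge_zero[of w] by linarith
    then show ?thesis
      unfolding q_def of_real_eq_0_iff by simp
  qed
  have key: "linearly_conjugate f (quad_stretch K \<theta> C) \<longleftrightarrow>
      beltrami (rcis K \<theta>) = \<mu> \<and> q (rcis K \<theta>) * C = c" if "K > 0" for K \<theta> C
  proof -
    have *: "linearly_conjugate (quad_stretch K \<theta> C)
        (beltrami_quad (beltrami (rcis K \<theta>)) (q (rcis K \<theta>) * C))"
      using quad_stretch_conjugate_beltrami_quad[OF that, of \<theta> C] that by (simp add: q_def)
    show ?thesis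
    proof
      assume "linearly_conjugate f (quad_stretch K \<theta> C)"
      then have "linearly_conjugate (beltrami_quad \<mu> c)
          (beltrami_quad (beltrami (rcis K \<theta>)) (q (rcis K \<theta>) * C))"
        using * f linearly_conjugate_sym linearly_conjugate_trans by blast
      then show "beltrami (rcis K \<theta>) = \<mu> \<and> q (rcis K \<theta>) * C = c"
        using beltrami_quad_conjugate_unique[OF \<mu>] by metis
    next
      assume "beltrami (rcis K \<theta>) = \<mu> \<and> q (rcis K \<theta>) * C = c"
      then show "linearly_conjugate f (quad_stretch K \<theta> C)"
        using * f linearly_conjugate_sym linearly_conjugate_trans by metis
    qed
  qed
  have "\<mu> \<in> beltrami ` param_region"
    using \<mu> bij_betw_imp_surj_on[OF bij_betw_beltrami] by simp
  then obtain w where w: "w \<in> param_region" "beltrami w = \<mu>"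
    by blast
  have "cmod w > 0"
    using w(1) by (auto simp: param_region_def)
  moreover have "w = rcis (cmod w) (Arg w)"
    by (simp only: rcis_cmod_Arg)
  moreover have "linearly_conjugate f (quad_stretch (cmod w) (Arg w) (c / q w))"
    using key[OF \<open>cmod w > 0\<close>] w(2) q[of w] by (simp add: rcis_cmod_Arg)
  ultimately have ex:
    "\<exists>K>0. \<exists>\<theta>. w = rcis K \<theta> \<and> linearly_conjugate f (quad_stretch K \<theta> (c / q w))"
    by blast
  have unique: "w' = w \<and> C = c / q w"
    if "w' \<in> param_region" "K > 0" "w' = rcis K \<theta>" "linearly_conjugate f (quad_stretch K \<theta> C)"
    for w' K \<theta> C
  proof -
    have "beltrami w' = \<mu>" "q w' * C = c"
      using key that by auto
    moreover have "w' = w"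
      using bij_betw_beltrami \<open>beltrami w' = \<mu>\<close> w that(1)
      unfolding bij_betw_def by (metis inj_onD)
    ultimately show ?thesis
      using q[of w] by (auto simp: field_simps)
  qed
  have "\<exists>!(w, C) \<in> param_region \<times> UNIV.
          \<exists>K>0. \<exists>\<theta>. w = rcis K \<theta> \<and> linearly_conjugate f (quad_stretch K \<theta> C)"
    using w(1) ex by (intro ex1I[of _ "(w, c / q w)"]) (auto dest: unique)
  then show ?thesis
    using ex by blast
qed

end
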